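(* Let $R$ be an associative ring with identity and let $M_1$ and $M_2$ be Rickart (unital right) $R$-modules. Suppose that: (1) $r_R(M_1)+r_R(M_2)=R$; (2) for all $i,j\in\{1,2\}$, the module $M_i$ is $M_j$-Rickart. Then $M=M_1\oplus M_2$ is a Rickart module.
   Context: For a right $R$-module $X$, $r_R(X)=\{r\in R : Xr=0\}$ is the annihilator of $X$ in $R$. A right $R$-module $M$ with endomorphism ring $S=\operatorname{End}_R(M)$ (acting on the left of $M$) is called a Rickart module if for every $\varphi\in S$ there is an idempotent $e=e^2\in S$ with $\operatorname{Ker}(\varphi)=eM$; equivalently, the kernel of every endomorphism of $M$ is a direct summand of $M$. For right $R$-modules $M$ and $N$, $M$ is called $N$-Rickart (or relatively Rickart to $N$) if for every $R$-homomorphism $\varphi\colon M\to N$, $\operatorname{Ker}(\varphi)$ is a direct summand of $M$. *)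

theory Defs
  imports "HOL-Algebra.Algebra"
begin

text \<open>
  The library locale \<open>module\<close> is restricted to commutative scalar rings, so right modules over an
  arbitrary ring are introduced here, on the library's record type \<open>module\<close>. The right action
  \<open>x \<cdot> r\<close> is written \<open>r \<odot> x\<close>; hence \<open>x \<cdot> (a b) = (x \<cdot> a) \<cdot> b\<close> becomes \<open>smult_assoc\<close> below.
  The library's \<open>submodule H R M\<close> assumes nothing about \<open>R\<close>: it says that \<open>H\<close> is an
  additive subgroup of \<open>M\<close> closed under the scalars, and is used unchanged.
\<close>

locale right_module = R?: ring R + M?: abelian_group M
  for R :: "('a, 'r) ring_scheme" (structure) and M :: "('a, 'b, 'm) module_scheme" (structure) +
  assumes smult_closed [simp, intro]:
      "\<lbrakk>a \<in> carrier R; x \<in> carrier M\<rbrakk> \<Longrightarrow> a \<odot>\<^bsub>M\<^esub> x \<in> carrier M"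
    and smult_add_scalar:
      "\<lbrakk>a \<in> carrier R; b \<in> carrier R; x \<in> carrier M\<rbrakk>
        \<Longrightarrow> (a \<oplus>\<^bsub>R\<^esub> b) \<odot>\<^bsub>M\<^esub> x = a \<odot>\<^bsub>M\<^esub> x \<oplus>\<^bsub>M\<^esub> b \<odot>\<^bsub>M\<^esub> x"
    and smult_add_vector:
      "\<lbrakk>a \<in> carrier R; x \<in> carrier M; y \<in> carrier M\<rbrakk>
        \<Longrightarrow> a \<odot>\<^bsub>M\<^esub> (x \<oplus>\<^bsub>M\<^esub> y) = a \<odot>\<^bsub>M\<^esub> x \<oplus>\<^bsub>M\<^esub> a \<odot>\<^bsub>M\<^esub> y"
    and smult_assoc:
      "\<lbrakk>a \<in> carrier R; b \<in> carrier R; x \<in> carrier M\<rbrakk>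
        \<Longrightarrow> (a \<otimes>\<^bsub>R\<^esub> b) \<odot>\<^bsub>M\<^esub> x = b \<odot>\<^bsub>M\<^esub> (a \<odot>\<^bsub>M\<^esub> x)"
    and smult_one [simp]:
      "x \<in> carrier M \<Longrightarrow> \<one>\<^bsub>R\<^esub> \<odot>\<^bsub>M\<^esub> x = x"

text \<open>
  As with the library's \<open>hom\<close>, homomorphisms are functions whose values outside the carrier
  are irrelevant; equality of homomorphisms means equality on the carrier.
\<close>

definition rmod_hom ::
  "('a, 'r) ring_scheme \<Rightarrow> ('a, 'b, 'm) module_scheme \<Rightarrow> ('a, 'c, 'n) module_scheme \<Rightarrow> ('b \<Rightarrow> 'c) set"
  where "rmod_hom R M N =
    {h \<in> hom (add_monoid M) (add_monoid N).
      \<forall>r \<in> carrier R. \<forall>x \<in> carrier M. h (r \<odot>\<^bsub>M\<^esub> x) = r \<odot>\<^bsub>N\<^esub> h x}"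

abbreviation rmod_end ::
  "('a, 'r) ring_scheme \<Rightarrow> ('a, 'b, 'm) module_scheme \<Rightarrow> ('b \<Rightarrow> 'b) set"
  where "rmod_end R M \<equiv> rmod_hom R M M"

definition annihilator :: "('a, 'r) ring_scheme \<Rightarrow> ('a, 'b, 'm) module_scheme \<Rightarrow> 'a set"
  where "annihilator R M = {r \<in> carrier R. \<forall>x \<in> carrier M. r \<odot>\<^bsub>M\<^esub> x = \<zero>\<^bsub>M\<^esub>}"

definition direct_summand ::
  "('a, 'r) ring_scheme \<Rightarrow> ('a, 'b, 'm) module_scheme \<Rightarrow> 'b set \<Rightarrow> bool"
  where "direct_summand R M H \<longleftrightarrow>
    submodule H R M \<and>
    (\<exists>K. submodule K R M \<and> H <+>\<^bsub>M\<^esub> K = carrier M \<and> H \<inter> K = {\<zero>\<^bsub>M\<^esub>})"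

definition rickart_module :: "('a, 'r) ring_scheme \<Rightarrow> ('a, 'b, 'm) module_scheme \<Rightarrow> bool"
  where "rickart_module R M \<longleftrightarrow>
    right_module R M \<and>
    (\<forall>\<phi> \<in> rmod_end R M. \<exists>e \<in> rmod_end R M.
      (\<forall>x \<in> carrier M. e (e x) = e x) \<and> a_kernel M M \<phi> = e ` carrier M)"

definition relatively_rickart ::
  "('a, 'r) ring_scheme \<Rightarrow> ('a, 'b, 'm) module_scheme \<Rightarrow> ('a, 'c, 'n) module_scheme \<Rightarrow> bool"
  \<comment> \<open>\<open>relatively_rickart R M N\<close>: the module \<open>M\<close> is \<open>N\<close>-Rickart\<close>
  where "relatively_rickart R M N \<longleftrightarrow>
    right_module R M \<and> right_module R N \<and>
    (\<forall>\<phi> \<in> rmod_hom R M N. direct_summand R M (a_kernel M N \<phi>))"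

text \<open>
  The record type \<open>module\<close> extends \<open>ring\<close>; the fields \<open>mult\<close> and \<open>one\<close> of a module, here inherited
  from \<open>RDirProd\<close>, play no role.
\<close>

definition module_direct_sum ::
  "('a, 'b, 'm) module_scheme \<Rightarrow> ('a, 'c, 'n) module_scheme \<Rightarrow> ('a, 'b \<times> 'c) module"
  where "module_direct_sum M N =
    ring.extend (RDirProd M N) \<lparr>smult = (\<lambda>r (x, y). (r \<odot>\<^bsub>M\<^esub> x, r \<odot>\<^bsub>N\<^esub> y))\<rparr>"

lemma module_direct_sum_simps [simp]:
  "carrier (module_direct_sum M N) = carrier M \<times> carrier N"
  "\<zero>\<^bsub>module_direct_sum M N\<^esub> = (\<zero>\<^bsub>M\<^esub>, \<zero>\<^bsub>N\<^esub>)"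
  "(x, y) \<oplus>\<^bsub>module_direct_sum M N\<^esub> (x', y') = (x \<oplus>\<^bsub>M\<^esub> x', y \<oplus>\<^bsub>N\<^esub> y')"
  "r \<odot>\<^bsub>module_direct_sum M N\<^esub> (x, y) = (r \<odot>\<^bsub>M\<^esub> x, r \<odot>\<^bsub>N\<^esub> y)"
  by (simp_all add: module_direct_sum_def RDirProd_def DirProd_def ring.defs monoid.defs)

lemma right_module_direct_sum:
  assumes "right_module R M" and "right_module R N"
  shows "right_module R (module_direct_sum M N)"
proof -
  interpret M: right_module R M by fact
  interpret N: right_module R N by fact
  have "abelian_group (module_direct_sum M N)"
  proof (rule abelian_groupI)
    fix p assume "p \<in> carrier (module_direct_sum M N)"
    then show "\<exists>q \<in> carrier (module_direct_sum M N).
        q \<oplus>\<^bsub>module_direct_sum M N\<^esub> p = \<zero>\<^bsub>module_direct_sum M N\<^esub>"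
      by (intro bexI[of _ "(\<ominus>\<^bsub>M\<^esub> fst p, \<ominus>\<^bsub>N\<^esub> snd p)"]) (auto simp: M.M.l_neg N.M.l_neg)
  qed (auto simp: M.M.a_ac N.M.a_ac)
  then show ?thesis
    by (intro right_module.intro right_module_axioms.intro M.R.ring_axioms)
      (auto simp: M.smult_add_scalar N.smult_add_scalar M.smult_add_vector N.smult_add_vector
        M.smult_assoc N.smult_assoc)
qed

end

theory Submission
  imports Defs
begin

text \<open>
  Write \<open>1 = a + b\<close> with \<open>M\<^sub>1 a = 0\<close> and \<open>M\<^sub>2 b = 0\<close>. A homomorphism \<open>h\<close> from \<open>M\<^sub>1\<close> to \<open>M\<^sub>2\<close>
  satisfies \<open>h x = h (x b) = (h x) b = 0\<close>, and likewise in the other direction. Hence every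
  endomorphism of the direct sum is diagonal, its kernel is the product of the kernels of its
  two entries, and the idempotents for the entries combine to a diagonal idempotent.
\<close>

lemma rmod_homI:
  assumes "\<And>x. x \<in> carrier M \<Longrightarrow> h x \<in> carrier N"
    and "\<And>x y. \<lbrakk>x \<in> carrier M; y \<in> carrier M\<rbrakk> \<Longrightarrow> h (x \<oplus>\<^bsub>M\<^esub> y) = h x \<oplus>\<^bsub>N\<^esub> h y"
    and "\<And>r x. \<lbrakk>r \<in> carrier R; x \<in> carrier M\<rbrakk> \<Longrightarrow> h (r \<odot>\<^bsub>M\<^esub> x) = r \<odot>\<^bsub>N\<^esub> h x"
  shows "h \<in> rmod_hom R M N"
  using assms by (auto simp: rmod_hom_def hom_def)

lemma rmod_hom_closed: "\<lbrakk>h \<in> rmod_hom R M N; x \<in> carrier M\<rbrakk> \<Longrightarrow> h x \<in> carrier N"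
  by (auto simp: rmod_hom_def hom_def)

lemma rmod_hom_add:
  "\<lbrakk>h \<in> rmod_hom R M N; x \<in> carrier M; y \<in> carrier M\<rbrakk> \<Longrightarrow> h (x \<oplus>\<^bsub>M\<^esub> y) = h x \<oplus>\<^bsub>N\<^esub> h y"
  by (auto simp: rmod_hom_def hom_def)

lemma rmod_hom_smult:
  "\<lbrakk>h \<in> rmod_hom R M N; r \<in> carrier R; x \<in> carrier M\<rbrakk> \<Longrightarrow> h (r \<odot>\<^bsub>M\<^esub> x) = r \<odot>\<^bsub>N\<^esub> h x"
  by (auto simp: rmod_hom_def)

lemma rmod_hom_comp:
  assumes "g \<in> rmod_hom R M N" and "h \<in> rmod_hom R N P"
  shows "h \<circ> g \<in> rmod_hom R M P"
  using assms by (intro rmod_homI) (simp_all add: rmod_hom_closed rmod_hom_add rmod_hom_smult)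

lemma fst_in_rmod_hom: "fst \<in> rmod_hom R (module_direct_sum M N) M"
  by (intro rmod_homI) auto

lemma snd_in_rmod_hom: "snd \<in> rmod_hom R (module_direct_sum M N) N"
  by (intro rmod_homI) auto

text \<open>Distributing the scalar over 0 + 0 = 0 gives t + t = t for t =
  \<open>r \<odot> \<zero>\<close>, and cancellation leaves t = 0.\<close>

lemma (in right_module) smult_zero:
  assumes "r \<in> carrier R"
  shows "r \<odot>\<^bsub>M\<^esub> \<zero>\<^bsub>M\<^esub> = \<zero>\<^bsub>M\<^esub>"
  using smult_add_vector[of r "\<zero>\<^bsub>M\<^esub>" "\<zero>\<^bsub>M\<^esub>"] assms
  by (metis M.add.l_cancel_one M.l_zero M.zero_closed smult_closed)

text \<open>The second coordinate stays zero because 0 + 0 = 0 and 0 r = 0 in \<open>N\<close>.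
  Together with the projections, the two insertions yield the matrix entries of an endomorphism of
  the sum.\<close>

lemma inl_in_rmod_hom:
  assumes "right_module R N"
  shows "(\<lambda>x. (x, \<zero>\<^bsub>N\<^esub>)) \<in> rmod_hom R M (module_direct_sum M N)"
proof -
  interpret N: right_module R N by fact
  show ?thesis by (intro rmod_homI) (auto simp: N.smult_zero)
qed

lemma inr_in_rmod_hom:
  assumes "right_module R M"
  shows "(\<lambda>y. (\<zero>\<^bsub>M\<^esub>, y)) \<in> rmod_hom R N (module_direct_sum M N)"
proof -
  interpret M: right_module R M by fact
  show ?thesis by (intro rmod_homI) (auto simp: M.smult_zero)
qed

text \<open>The operations of a direct sum are componentwise, so a diagonal map is linear. This is
  how idempotents of the summands become an endomorphism of the sum.\<close>

lemma map_prod_in_rmod_hom: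
  assumes "g \<in> rmod_hom R M P" and "h \<in> rmod_hom R N Q"
  shows "map_prod g h \<in> rmod_hom R (module_direct_sum M N) (module_direct_sum P Q)"
  using assms by (intro rmod_homI) (auto simp: rmod_hom_closed rmod_hom_add rmod_hom_smult)

lemma rmod_hom_eq_zero_if_annihilators_comaximal:
  assumes "right_module R M" and "right_module R N"
    and comax: "annihilator R M <+>\<^bsub>R\<^esub> annihilator R N = carrier R"
    and h: "h \<in> rmod_hom R M N" and x: "x \<in> carrier M"
  shows "h x = \<zero>\<^bsub>N\<^esub>"
proof -
  interpret M: right_module R M by fact
  interpret N: right_module R N by fact
  obtain a b where a: "a \<in> annihilator R M" and b: "b \<in> annihilator R N"
    and one: "\<one>\<^bsub>R\<^esub> = a \<oplus>\<^bsub>R\<^esub> b"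
    using comax M.R.one_closed by (auto simp: set_add_def' elim!: equalityE)
  have carr: "a \<in> carrier R" "b \<in> carrier R"
    using a b by (auto simp: annihilator_def)
  \<comment> \<open>Since \<open>a\<close> kills \<open>M\<close>, the scalar \<open>b\<close> acts
    on \<open>M\<close> as the identity.\<close>
  have "x = (a \<oplus>\<^bsub>R\<^esub> b) \<odot>\<^bsub>M\<^esub> x"
    using one x M.smult_one by metis
  also have "\<dots> = b \<odot>\<^bsub>M\<^esub> x"
    using a x carr by (simp add: M.smult_add_scalar annihilator_def)
  \<comment> \<open>Linearity carries \<open>b\<close> over to \<open>N\<close>, where it acts as
    zero.\<close>
  finally have "h x = b \<odot>\<^bsub>N\<^esub> h x"
    using rmod_hom_smult[OF h carr(2) x] by simp
  also have "\<dots> = \<zero>\<^bsub>N\<^esub>"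
    using b rmod_hom_closed[OF h x] by (simp add: annihilator_def)
  finally show ?thesis .
qed

text \<open>View \<phi> as a 2 by 2 matrix of homomorphisms: \<open>MN\<close> and \<open>NM\<close>
  force the off-diagonal entries to vanish, so \<open>g\<close> and \<open>h\<close> are the
  diagonal ones.\<close>

lemma rmod_end_direct_sum_diagonal:
  assumes M: "right_module R M" and N: "right_module R N"
    and MN: "\<And>h x. \<lbrakk>h \<in> rmod_hom R M N; x \<in> carrier M\<rbrakk> \<Longrightarrow> h x = \<zero>\<^bsub>N\<^esub>"
    and NM: "\<And>h y. \<lbrakk>h \<in> rmod_hom R N M; y \<in> carrier N\<rbrakk> \<Longrightarrow> h y = \<zero>\<^bsub>M\<^esub>"
    and \<phi>: "\<phi> \<in> rmod_end R (module_direct_sum M N)"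
  obtains g h where "g \<in> rmod_end R M" and "h \<in> rmod_end R N"
    and "\<And>x y. \<lbrakk>x \<in> carrier M; y \<in> carrier N\<rbrakk> \<Longrightarrow> \<phi> (x, y) = (g x, h y)"
proof
  interpret M: right_module R M by fact
  interpret N: right_module R N by fact
  let ?inl = "\<lambda>x. (x, \<zero>\<^bsub>N\<^esub>)" and ?inr = "\<lambda>y. (\<zero>\<^bsub>M\<^esub>, y)"
  have inl: "\<phi> \<circ> ?inl \<in> rmod_hom R M (module_direct_sum M N)"
    using inl_in_rmod_hom[OF N] \<phi> by (rule rmod_hom_comp)
  have inr: "\<phi> \<circ> ?inr \<in> rmod_hom R N (module_direct_sum M N)"
    using inr_in_rmod_hom[OF M] \<phi> by (rule rmod_hom_comp)
  show g: "fst \<circ> (\<phi> \<circ> ?inl) \<in> rmod_end R M"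
    using inl fst_in_rmod_hom by (rule rmod_hom_comp)
  show h: "snd \<circ> (\<phi> \<circ> ?inr) \<in> rmod_end R N"
    using inr snd_in_rmod_hom by (rule rmod_hom_comp)
  fix x y assume xy: "x \<in> carrier M" "y \<in> carrier N"
  \<comment> \<open>This is the off-diagonal entry from \<open>M\<close> to \<open>N\<close>; the
    one from \<open>N\<close> to \<open>M\<close> follows below.\<close>
  have "snd (\<phi> (x, \<zero>\<^bsub>N\<^esub>)) = \<zero>\<^bsub>N\<^esub>"
    using MN[OF rmod_hom_comp[OF inl snd_in_rmod_hom] xy(1)] by simp
  then have x: "\<phi> (x, \<zero>\<^bsub>N\<^esub>) = ((fst \<circ> (\<phi> \<circ> ?inl)) x, \<zero>\<^bsub>N\<^esub>)"
    by (simp add: prod_eq_iff)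
  have "fst (\<phi> (\<zero>\<^bsub>M\<^esub>, y)) = \<zero>\<^bsub>M\<^esub>"
    using NM[OF rmod_hom_comp[OF inr fst_in_rmod_hom] xy(2)] by simp
  then have y: "\<phi> (\<zero>\<^bsub>M\<^esub>, y) = (\<zero>\<^bsub>M\<^esub>, (snd \<circ> (\<phi> \<circ> ?inr)) y)"
    by (simp add: prod_eq_iff)
  \<comment> \<open>Additivity of \<phi> is applied to (x, y) = (x, 0) + (0, y).\<close>
  have "\<phi> (x, y) = \<phi> (x, \<zero>\<^bsub>N\<^esub>) \<oplus>\<^bsub>module_direct_sum M N\<^esub> \<phi> (\<zero>\<^bsub>M\<^esub>, y)"
    using rmod_hom_add[OF \<phi>, of "(x, \<zero>\<^bsub>N\<^esub>)" "(\<zero>\<^bsub>M\<^esub>, y)"] xy by simp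
  also have "\<dots> = ((fst \<circ> (\<phi> \<circ> ?inl)) x, (snd \<circ> (\<phi> \<circ> ?inr)) y)"
    unfolding x y module_direct_sum_simps
    using rmod_hom_closed[OF g xy(1)] rmod_hom_closed[OF h xy(2)]
    by (simp only: M.M.r_zero N.M.l_zero)
  finally show "\<phi> (x, y) = ((fst \<circ> (\<phi> \<circ> ?inl)) x, (snd \<circ> (\<phi> \<circ> ?inr)) y)" .
qed

theorem corollary2p6:
  fixes R :: "('a, 'r) ring_scheme"
    and M\<^sub>1 :: "('a, 'b, 'm) module_scheme"
    and M\<^sub>2 :: "('a, 'c, 'n) module_scheme"
  assumes "ring R"
    and "rickart_module R M\<^sub>1" and "rickart_module R M\<^sub>2"
    and "annihilator R M\<^sub>1 <+>\<^bsub>R\<^esub> annihilator R M\<^sub>2 = carrier R"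
    and "relatively_rickart R M\<^sub>1 M\<^sub>1" and "relatively_rickart R M\<^sub>1 M\<^sub>2"
    and "relatively_rickart R M\<^sub>2 M\<^sub>1" and "relatively_rickart R M\<^sub>2 M\<^sub>2"
  shows "rickart_module R (module_direct_sum M\<^sub>1 M\<^sub>2)"
proof -
  have M: "right_module R M\<^sub>1" "right_module R M\<^sub>2"
    using assms(2,3) by (auto simp: rickart_module_def)
  interpret ring R by fact
  \<comment> \<open>Homomorphisms from \<open>M\<^sub>2\<close> to \<open>M\<^sub>1\<close> must
    vanish too, which calls for the annihilators in the opposite order.\<close>
  have comm: "annihilator R M\<^sub>2 <+>\<^bsub>R\<^esub> annihilator R M\<^sub>1 = carrier R"
    using assms(4) set_add_comm[of "annihilator R M\<^sub>1" "annihilator R M\<^sub>2"]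
    by (auto simp: annihilator_def)
  have "\<exists>e \<in> rmod_end R (module_direct_sum M\<^sub>1 M\<^sub>2).
      (\<forall>p \<in> carrier (module_direct_sum M\<^sub>1 M\<^sub>2). e (e p) = e p) \<and>
      a_kernel (module_direct_sum M\<^sub>1 M\<^sub>2) (module_direct_sum M\<^sub>1 M\<^sub>2) \<phi> =
        e ` carrier (module_direct_sum M\<^sub>1 M\<^sub>2)"
    if \<phi>: "\<phi> \<in> rmod_end R (module_direct_sum M\<^sub>1 M\<^sub>2)" for \<phi>
  proof -
    obtain g h where g: "g \<in> rmod_end R M\<^sub>1" and h: "h \<in> rmod_end R M\<^sub>2"
      and gh: "\<And>x y. \<lbrakk>x \<in> carrier M\<^sub>1; y \<in> carrier M\<^sub>2\<rbrakk> \<Longrightarrow> \<phi> (x, y) = (g x, h y)"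
      \<comment> \<open>The two open premises say that homomorphisms between the summands vanish;
        they follow from comaximality, read in each of the two orders.\<close>
      by (rule rmod_end_direct_sum_diagonal[OF M _ _ \<phi>])
        (blast intro: rmod_hom_eq_zero_if_annihilators_comaximal[OF M assms(4)]
          rmod_hom_eq_zero_if_annihilators_comaximal[OF M(2,1) comm])+
    obtain e where e: "e \<in> rmod_end R M\<^sub>1" "\<And>x. x \<in> carrier M\<^sub>1 \<Longrightarrow> e (e x) = e x"
      and ker_g: "a_kernel M\<^sub>1 M\<^sub>1 g = e ` carrier M\<^sub>1"
      using assms(2) g unfolding rickart_module_def by blast
    obtain f where f: "f \<in> rmod_end R M\<^sub>2" "\<And>y. y \<in> carrier M\<^sub>2 \<Longrightarrow> f (f y) = f y"
      and ker_h: "a_kernel M\<^sub>2 M\<^sub>2 h = f ` carrier M\<^sub>2"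
      using assms(3) h unfolding rickart_module_def by blast
    \<comment> \<open>A pair (g x, h y) is zero exactly when both coordinates are.\<close>
    have "a_kernel (module_direct_sum M\<^sub>1 M\<^sub>2) (module_direct_sum M\<^sub>1 M\<^sub>2) \<phi> =
        a_kernel M\<^sub>1 M\<^sub>1 g \<times> a_kernel M\<^sub>2 M\<^sub>2 h"
      using gh by (auto simp: a_kernel_def')
    \<comment> \<open>A product of images is the image of the product under the diagonal
      map.\<close>
    also have "\<dots> = map_prod e f ` carrier (module_direct_sum M\<^sub>1 M\<^sub>2)"
      by (simp add: ker_g ker_h map_prod_surj_on[OF refl refl])
    finally show ?thesis
      using map_prod_in_rmod_hom[OF e(1) f(1)] e(2) f(2)
      by (intro bexI[of _ "map_prod e f"]) auto
  qed
  then show ?thesis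
    using right_module_direct_sum[OF M] by (simp only: rickart_module_def) blast
qed

end
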